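(* Let $\Gamma$ be a finitely generated group and let $f_1\in\mathcal{P}(\Gamma)$ be a parallelogram function. (1) If there exists a function $f_2\colon\Gamma\to\mathbb{C}$ such that $u_\gamma\mapsto tf_1(\gamma)+t^2f_2(\gamma)$ (for $\gamma\in\Gamma$) defines a $\mathbb{C}$-algebra morphism $A(\Gamma)^{\mathrm{SL}_2(\mathbb{C})}\to\mathbb{C}[t]/(t^3)$, then $f_1$ is a quadratic form. (2) If there exist functions $f_2,f_3\colon\Gamma\to\mathbb{C}$ such that $u_\gamma\mapsto tf_1(\gamma)+t^2f_2(\gamma)+t^3f_3(\gamma)$ (for $\gamma\in\Gamma$) defines a $\mathbb{C}$-algebra morphism $A(\Gamma)^{\mathrm{SL}_2(\mathbb{C})}\to\mathbb{C}[t]/(t^4)$, then $f_1$ is a quadratic form of rank $\leqslant 2$.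
   Context: $\mathcal{P}(\Gamma)$ is the set of parallelogram functions, i.e. functions $f\colon\Gamma\to\mathbb{C}$ with $f(xy)+f(xy^{-1})=2f(x)+2f(y)$ for all $x,y\in\Gamma$. A quadratic form on $\Gamma$ is a function of the form $f(\gamma)=b(\gamma,\gamma)$ with $b\colon\Gamma\times\Gamma\to\mathbb{C}$ a bimorphism (a group morphism in each variable); $b$ may be taken symmetric, it then induces a symmetric bilinear form on $H_1(\Gamma,\mathbb{C})$, and the rank of $f$ is the rank of this bilinear form. $R(\Gamma)=\mathrm{Hom}(\Gamma,\mathrm{SL}_2(\mathbb{C}))$, and $A(\Gamma)$ is its (possibly non-reduced) ring of regular functions: the $\mathbb{C}$-algebra generated by the entries $a^l_{i,j}$ of the matrices $\rho(\gamma_l)$, for $\gamma_1,\dots,\gamma_n$ generating $\Gamma$, modulo the relations coming from $\det\rho(\gamma_l)=1$ and from the relations of $\Gamma$. $\mathrm{SL}_2(\mathbb{C})$ acts by conjugation and $A(\Gamma)^{\mathrm{SL}_2(\mathbb{C})}$ is the subalgebra of invariants. For $\gamma\in\Gamma$, $t_\gamma\in A(\Gamma)^{\mathrm{SL}_2(\mathbb{C})}$ is the function $t_\gamma(\rho)=\mathrm{Tr}\,\rho(\gamma)$, and $u_\gamma=t_\gamma-2$. By a known theorem, $A(\Gamma)^{\mathrm{SL}_2(\mathbb{C})}$ is generated by the $t_\gamma$, and the ideal of relations among them is generated by $t_1=2$ and $t_\gamma t_\delta=t_{\gamma\delta}+t_{\gamma\delta^{-1}}$ ($\gamma,\delta\in\Gamma$);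 in terms of the $u_\gamma$: $u_1=0$ and $u_{\gamma\delta}+u_{\gamma\delta^{-1}}=2u_\gamma+2u_\delta+u_\gamma u_\delta$. *)

theory Defs
  imports
    "HOL-Analysis.Determinants"
    "HOL-Algebra.QuotRing"
    "HOL-Algebra.Generated_Groups"
    "HOL-Library.Poly_Mapping"
    "HOL-Library.Function_Algebras"
    "HOL-Computational_Algebra.Polynomial"
begin

section \<open>Parallelogram functions and quadratic forms on a group\<close>

definition parallelogram_functions :: "('a, 'c) monoid_scheme \<Rightarrow> ('a \<Rightarrow> complex) set" where
  "parallelogram_functions G =
     {f. \<forall>x\<in>carrier G. \<forall>y\<in>carrier G.
           f (x \<otimes>\<^bsub>G\<^esub> y) + f (x \<otimes>\<^bsub>G\<^esub> inv\<^bsub>G\<^esub> y) = 2 * f x + 2 * f y}"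

definition bimorphism :: "('a, 'c) monoid_scheme \<Rightarrow> ('a \<Rightarrow> 'a \<Rightarrow> complex) \<Rightarrow> bool" where
  "bimorphism G b \<longleftrightarrow>
     (\<forall>x\<in>carrier G. \<forall>y\<in>carrier G. \<forall>z\<in>carrier G.
        b (x \<otimes>\<^bsub>G\<^esub> y) z = b x z + b y z \<and>
        b x (y \<otimes>\<^bsub>G\<^esub> z) = b x y + b x z)"

definition quadratic_form :: "('a, 'c) monoid_scheme \<Rightarrow> ('a \<Rightarrow> complex) \<Rightarrow> bool" where
  "quadratic_form G f \<longleftrightarrow> (\<exists>b. bimorphism G b \<and> (\<forall>x\<in>carrier G. f x = b x x))"

text \<open>
  The first homology with complex coefficients, computed from the bar complex: the
  1-chains are the finitely supported functions on the group, all of them are cycles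
  (the coefficients being trivial), and the boundaries are spanned by the elements
  \<open>[y] - [x y] + [x]\<close>.
\<close>

definition chain_scale :: "complex \<Rightarrow> ('a \<Rightarrow>\<^sub>0 complex) \<Rightarrow> ('a \<Rightarrow>\<^sub>0 complex)" where
  "chain_scale c = Poly_Mapping.map ((*) c)"

definition chains1 :: "('a, 'c) monoid_scheme \<Rightarrow> ('a \<Rightarrow>\<^sub>0 complex) set" where
  "chains1 G = {v. Poly_Mapping.keys v \<subseteq> carrier G}"

definition boundaries1 :: "('a, 'c) monoid_scheme \<Rightarrow> ('a \<Rightarrow>\<^sub>0 complex) set" where
  "boundaries1 G = module.span chain_scale
     {Poly_Mapping.single y 1 - Poly_Mapping.single (x \<otimes>\<^bsub>G\<^esub> y) 1 + Poly_Mapping.single x 1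
       | x y. x \<in> carrier G \<and> y \<in> carrier G}"

definition H1 :: "('a, 'c) monoid_scheme \<Rightarrow> ('a \<Rightarrow>\<^sub>0 complex) set set" where
  "H1 G = chains1 G //
     {(v, w). v \<in> chains1 G \<and> w \<in> chains1 G \<and> v - w \<in> boundaries1 G}"

definition chain_form :: "('a \<Rightarrow> 'a \<Rightarrow> complex) \<Rightarrow> ('a \<Rightarrow>\<^sub>0 complex) \<Rightarrow> ('a \<Rightarrow>\<^sub>0 complex) \<Rightarrow> complex" where
  "chain_form b v w =
     (\<Sum>x\<in>Poly_Mapping.keys v. \<Sum>y\<in>Poly_Mapping.keys w.
        Poly_Mapping.lookup v x * Poly_Mapping.lookup w y * b x y)"

text \<open>
  The form induced on the quotient: for a bimorphism \<open>b\<close> the set of values below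
  is a singleton.
\<close>

definition H1_form :: "('a \<Rightarrow> 'a \<Rightarrow> complex) \<Rightarrow>
    ('a \<Rightarrow>\<^sub>0 complex) set \<Rightarrow> ('a \<Rightarrow>\<^sub>0 complex) set \<Rightarrow> complex" where
  "H1_form b X Y = the_elem ((\<lambda>(v, w). chain_form b v w) ` (X \<times> Y))"

text \<open>
  The rank of a bilinear form \<open>B\<close> on a space \<open>V\<close> is the dimension of the image of
  \<open>V\<close> in its dual under \<open>x \<mapsto> B x\<close>; functionals are represented as functions that
  vanish outside \<open>V\<close>.  (\<open>vector_space.dim\<close> is 0 on infinite-dimensional spaces, which
  do not occur here: \<open>H1 G\<close> is finite-dimensional for finitely generated \<open>G\<close>.)
\<close>

definition form_rank :: "'v set \<Rightarrow> ('v \<Rightarrow> 'v \<Rightarrow> complex) \<Rightarrow> nat" where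
  "form_rank V B = vector_space.dim (\<lambda>c (\<phi> :: 'v \<Rightarrow> complex) y. c * \<phi> y)
     ((\<lambda>x y. if y \<in> V then B x y else 0) ` V)"

text \<open>
  The symmetric \<open>b\<close> is determined on the carrier by \<open>f\<close> (polarization), so the rank is
  a function of \<open>f\<close>.
\<close>

definition quadratic_form_of_rank ::
    "('a, 'c) monoid_scheme \<Rightarrow> ('a \<Rightarrow> complex) \<Rightarrow> nat \<Rightarrow> bool" where
  "quadratic_form_of_rank G f r \<longleftrightarrow>
     (\<exists>b. bimorphism G b \<and>
          (\<forall>x\<in>carrier G. \<forall>y\<in>carrier G. b x y = b y x) \<and>
          (\<forall>x\<in>carrier G. f x = b x x) \<and>
          form_rank (H1 G) (H1_form b) = r)"


section \<open>The coordinate ring of the scheme of \<open>SL\<^sub>2\<close>-representations\<close>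

text \<open>
  Polynomials in the entries \<open>a\<^sup>l\<^sub>i\<^sub>j\<close> of one \<open>2 \<times> 2\<close> matrix for each generator, the
  generators being indexed by the finite type \<open>'n\<close>.  A polynomial is a finitely supported
  map from exponent vectors to coefficients.
\<close>

type_synonym 'n entry_poly = "(('n \<times> 2 \<times> 2) \<Rightarrow>\<^sub>0 nat) \<Rightarrow>\<^sub>0 complex"

definition univ_ring :: "('r :: comm_ring_1) ring" where
  "univ_ring = \<lparr>carrier = UNIV, mult = (*), one = 1, zero = 0, add = (+)\<rparr>"

definition const_poly :: "complex \<Rightarrow> 'n entry_poly" where
  "const_poly c = Poly_Mapping.single 0 c"

definition poly_subst :: "('n \<times> 2 \<times> 2 \<Rightarrow> 'n entry_poly) \<Rightarrow> 'n entry_poly \<Rightarrow> 'n entry_poly" where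
  "poly_subst \<theta> p =
     (\<Sum>m\<in>Poly_Mapping.keys p. const_poly (Poly_Mapping.lookup p m) *
        (\<Prod>x\<in>Poly_Mapping.keys m. \<theta> x ^ Poly_Mapping.lookup m x))"

definition generic_matrix :: "'n \<Rightarrow> 'n entry_poly^2^2" where
  "generic_matrix l = (\<chi> i j. Poly_Mapping.single (Poly_Mapping.single (l, i, j) 1) 1)"

definition adjugate2 :: "'r^2^2 \<Rightarrow> ('r :: comm_ring_1)^2^2" where
  "adjugate2 A = vector [vector [A $ 2 $ 2, - (A $ 1 $ 2)], vector [- (A $ 2 $ 1), A $ 1 $ 1]]"

text \<open>
  Words in the generators and their inverses: \<open>(l, True)\<close> stands for the generator
  \<open>\<gamma> l\<close>, \<open>(l, False)\<close> for its inverse.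
\<close>

type_synonym 'n gen_word = "('n \<times> bool) list"

primrec word_eval :: "('a, 'c) monoid_scheme \<Rightarrow> ('n \<Rightarrow> 'a) \<Rightarrow> 'n gen_word \<Rightarrow> 'a" where
  "word_eval G \<gamma> [] = \<one>\<^bsub>G\<^esub>"
| "word_eval G \<gamma> (s # w) =
     (if snd s then \<gamma> (fst s) else inv\<^bsub>G\<^esub> (\<gamma> (fst s))) \<otimes>\<^bsub>G\<^esub> word_eval G \<gamma> w"

primrec word_matrix :: "'n gen_word \<Rightarrow> 'n entry_poly^2^2" where
  "word_matrix [] = mat 1"
| "word_matrix (s # w) =
     (if snd s then generic_matrix (fst s) else adjugate2 (generic_matrix (fst s))) ** word_matrix w"

definition rep_relations :: "('a, 'c) monoid_scheme \<Rightarrow> ('n \<Rightarrow> 'a) \<Rightarrow> 'n entry_poly set" where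
  "rep_relations G \<gamma> =
     {det (generic_matrix l) - 1 | l. True} \<union>
     {(word_matrix w - mat 1) $ i $ j | w i j. word_eval G \<gamma> w = \<one>\<^bsub>G\<^esub>}"

definition rep_ideal :: "('a, 'c) monoid_scheme \<Rightarrow> ('n \<Rightarrow> 'a) \<Rightarrow> 'n entry_poly set" where
  "rep_ideal G \<gamma> = Idl\<^bsub>univ_ring\<^esub> (rep_relations G \<gamma>)"

definition rep_ring :: "('a, 'c) monoid_scheme \<Rightarrow> ('n \<Rightarrow> 'a) \<Rightarrow> 'n entry_poly set ring" where
  "rep_ring G \<gamma> = univ_ring Quot (rep_ideal G \<gamma>)"

definition rep_class ::
    "('a, 'c) monoid_scheme \<Rightarrow> ('n \<Rightarrow> 'a) \<Rightarrow> 'n entry_poly \<Rightarrow> 'n entry_poly set" where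
  "rep_class G \<gamma> p = rep_ideal G \<gamma> +>\<^bsub>univ_ring\<^esub> p"

text \<open>
  Conjugation \<open>\<rho> \<mapsto> g \<rho> g\<^sup>-\<^sup>1\<close> acts on regular functions by
  \<open>(g F)(\<rho>) = F (g\<^sup>-\<^sup>1 \<rho> g)\<close>.  The corresponding automorphism of the polynomial ring maps
  the relation ideal onto itself, hence cosets to cosets.
\<close>

definition const_matrix :: "complex^2^2 \<Rightarrow> 'n entry_poly^2^2" where
  "const_matrix g = (\<chi> i j. const_poly (g $ i $ j))"

definition conj_poly :: "complex^2^2 \<Rightarrow> 'n entry_poly \<Rightarrow> 'n entry_poly" where
  "conj_poly g = poly_subst (\<lambda>(l, i, j).
     (const_matrix (matrix_inv g) ** generic_matrix l ** const_matrix g) $ i $ j)"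

definition invariant_ring ::
    "('a, 'c) monoid_scheme \<Rightarrow> ('n \<Rightarrow> 'a) \<Rightarrow> 'n entry_poly set ring" where
  "invariant_ring G \<gamma> = (rep_ring G \<gamma>)
     \<lparr>carrier := {F \<in> carrier (rep_ring G \<gamma>). \<forall>g. det g = 1 \<longrightarrow> conj_poly g ` F = F}\<rparr>"

text \<open>
  The relations make the coset below independent of the word chosen to represent \<open>x\<close>.
\<close>

definition trace_function ::
    "('a, 'c) monoid_scheme \<Rightarrow> ('n \<Rightarrow> 'a) \<Rightarrow> 'a \<Rightarrow> 'n entry_poly set" where
  "trace_function G \<gamma> x = rep_class G \<gamma> (trace (word_matrix (SOME w. word_eval G \<gamma> w = x)))"

definition u_function ::
    "('a, 'c) monoid_scheme \<Rightarrow> ('n \<Rightarrow> 'a) \<Rightarrow> 'a \<Rightarrow> 'n entry_poly set" where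
  "u_function G \<gamma> x =
     trace_function G \<gamma> x \<ominus>\<^bsub>rep_ring G \<gamma>\<^esub> rep_class G \<gamma> (const_poly 2)"


section \<open>Algebra morphisms to truncated polynomial rings\<close>

definition trunc_class :: "nat \<Rightarrow> complex poly \<Rightarrow> complex poly set" where
  "trunc_class N p = (PIdl\<^bsub>univ_ring\<^esub> (monom 1 N)) +>\<^bsub>univ_ring\<^esub> p"

definition trunc_ring :: "nat \<Rightarrow> complex poly set ring" where
  "trunc_ring N = univ_ring Quot (PIdl\<^bsub>univ_ring\<^esub> (monom 1 N))"

text \<open>
  A complex algebra is given by a ring together with its structure map from the complex
  numbers.
\<close>

definition algebra_hom ::
    "('r, 'c) ring_scheme \<Rightarrow> (complex \<Rightarrow> 'r) \<Rightarrow> ('s, 'd) ring_scheme \<Rightarrow> (complex \<Rightarrow> 's) \<Rightarrow> ('r \<Rightarrow> 's) set" where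
  "algebra_hom R \<iota> S \<kappa> = {\<phi> \<in> ring_hom R S. \<forall>c. \<phi> (\<iota> c) = \<kappa> c}"

text \<open>
  The assignment \<open>u\<^sub>x \<mapsto> q x\<close> defines an algebra morphism from the ring of invariants to
  \<open>\<complex>[t]/(t\<^sup>N)\<close>.
\<close>

definition defines_morphism ::
    "('a, 'c) monoid_scheme \<Rightarrow> ('n \<Rightarrow> 'a) \<Rightarrow> nat \<Rightarrow> ('a \<Rightarrow> complex poly) \<Rightarrow> bool" where
  "defines_morphism G \<gamma> N q \<longleftrightarrow>
     (\<exists>\<phi> \<in> algebra_hom (invariant_ring G \<gamma>) (\<lambda>c. rep_class G \<gamma> (const_poly c))
                     (trunc_ring N) (\<lambda>c. trunc_class N [:c:]).
        \<forall>x\<in>carrier G. \<phi> (u_function G \<gamma> x) = trunc_class N (q x))"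

end

theory Submission
  imports Defs
begin

text \<open>
  Write \<open>\<tau> x = 2 + q x\<close> for the image of the trace function \<open>t\<^sub>x\<close> under a morphism to
  \<open>\<complex>[t]/(t\<^sup>N)\<close> with \<open>q x = t f\<^sub>1(x) + \<dots>\<close>.  Everything follows from one
  identity between traces of \<open>2 \<times> 2\<close> matrices over a commutative ring (\<open>det_polar_trace\<close>):
  with \<open>D(X) = tr(X\<^sub>1X\<^sub>2X\<^sub>3) - tr(X\<^sub>1X\<^sub>3X\<^sub>2)\<close>, the \<open>3 \<times> 3\<close> determinant of the
  entries \<open>2 tr(X\<^sub>iY\<^sub>j) - tr X\<^sub>i tr Y\<^sub>j\<close> equals \<open>- 4 D(X) D(Y)\<close>.  Traces of words in the generic
  matrices are invariant under conjugation and represent the functions \<open>t\<^sub>x\<close>, so the morphism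
  may be applied to this identity (\<open>morphism_det_identity\<close>).

  Let \<open>b(x,y) = (f\<^sub>1(xy) - f\<^sub>1(x) - f\<^sub>1(y))/2\<close>.  The entry \<open>2 \<tau>(xy) - \<tau>(x) \<tau>(y)\<close> is
  \<open>4 t b(x,y) + O(t\<^sup>2)\<close>, so the determinant is \<open>64 t\<^sup>3 det b(x\<^sub>i,y\<^sub>j) + O(t\<^sup>4)\<close>, while
  \<open>D(x) = t (f\<^sub>1(x\<^sub>1x\<^sub>2x\<^sub>3) - f\<^sub>1(x\<^sub>1x\<^sub>3x\<^sub>2)) + O(t\<^sup>2)\<close>.

  Modulo \<open>t\<^sup>3\<close> the identity for \<open>x = y\<close> says that the square of this difference vanishes:
  \<open>f\<^sub>1\<close> does not see the order of the factors (\<open>morphism_exchange_invariant\<close>), and the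
  Jordan-von Neumann argument makes \<open>b\<close> a bimorphism, as on an abelian group
  (\<open>parallelogram_polar_form\<close>).  This is the first claim.

  Modulo \<open>t\<^sup>4\<close> both factors \<open>D\<close> are therefore divisible by \<open>t\<^sup>2\<close>, their product vanishes, and so
  do all the determinants \<open>det b(x\<^sub>i,y\<^sub>j)\<close> (\<open>morphism_minors_vanish\<close>).  A kernel
  without nonzero \<open>3 \<times> 3\<close> minors is a sum of two products \<open>\<alpha>(x) g(y) + \<beta>(x) h(y)\<close>, hence all
  functionals that \<open>b\<close> induces on \<open>H\<^sub>1\<close> lie in the span of two functions
  (\<open>vanishing_minors_factor\<close>, \<open>form_rank_le_2\<close>).  This is the second claim.
\<close>

section \<open>Parallelogram functions that ignore the order of the factors\<close>

lemma parallelogramD: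
  assumes "f \<in> parallelogram_functions G" "x \<in> carrier G" "y \<in> carrier G"
  shows "f (x \<otimes>\<^bsub>G\<^esub> y) + f (x \<otimes>\<^bsub>G\<^esub> inv\<^bsub>G\<^esub> y) = 2 * f x + 2 * f y"
  using assms by (auto simp: parallelogram_functions_def)

definition polar_form :: "('a, 'c) monoid_scheme \<Rightarrow> ('a \<Rightarrow> complex) \<Rightarrow> 'a \<Rightarrow> 'a \<Rightarrow> complex" where
  "polar_form G f x y = (f (x \<otimes>\<^bsub>G\<^esub> y) - f x - f y) / 2"

text \<open>
  In an abelian group the parallelogram law forces the polar form to be additive.  The computation
  only permutes factors inside products of three elements, so it survives in any group once \<open>f\<close> is
  insensitive to exchanging the last two of three factors; taking the first factor to be the
  identity gives \<open>f(xy) = f(yx)\<close>.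
\<close>

lemma parallelogram_polar_form:
  fixes G (structure)
  assumes "group G" and f: "f \<in> parallelogram_functions G"
    and comm: "\<And>a b c. a \<in> carrier G \<Longrightarrow> b \<in> carrier G \<Longrightarrow> c \<in> carrier G \<Longrightarrow>
      f (a \<otimes>\<^bsub>G\<^esub> b \<otimes>\<^bsub>G\<^esub> c) = f (a \<otimes>\<^bsub>G\<^esub> c \<otimes>\<^bsub>G\<^esub> b)"
  shows "bimorphism G (polar_form G f)"
    and "x \<in> carrier G \<Longrightarrow> y \<in> carrier G \<Longrightarrow> polar_form G f x y = polar_form G f y x"
    and "x \<in> carrier G \<Longrightarrow> f x = polar_form G f x x"
proof -
  interpret group G by fact
  note pl = parallelogramD[OF f]
  have one: "f \<one> = 0"
    using pl[of \<one> \<one>] by simp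
  have comm2: "f (x \<otimes> y) = f (y \<otimes> x)" if "x \<in> carrier G" "y \<in> carrier G" for x y
    using comm[of \<one> x y] that by simp
  show sym: "polar_form G f x y = polar_form G f y x" if "x \<in> carrier G" "y \<in> carrier G" for x y
    using comm2[OF that] by (simp add: polar_form_def)
  show "f x = polar_form G f x x" if "x \<in> carrier G" for x
    using pl[of x x] that one by (simp add: polar_form_def r_inv)
  have three: "f (x \<otimes> y \<otimes> z) = f (x \<otimes> z) + f (y \<otimes> z) + f (x \<otimes> y) - f x - f y - f z"
    if [simp]: "x \<in> carrier G" "y \<in> carrier G" "z \<in> carrier G" for x y z
  proof -
    \<comment> \<open>the law for \<open>(xz, y)\<close>, \<open>(yz, x)\<close> and \<open>(z, xy\<inverse>)\<close>; adding the first two and subtracting the third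
      leaves \<open>f (xyz)\<close> and values at products of two\<close>
    have 1: "f (x \<otimes> y \<otimes> z) + f (x \<otimes> inv y \<otimes> z) = 2 * f (x \<otimes> z) + 2 * f y"
      using pl[of "x \<otimes> z" y] comm[of x z y] comm[of x z "inv y"] by simp
    have "f (y \<otimes> z \<otimes> x) = f (x \<otimes> y \<otimes> z)" "f (y \<otimes> z \<otimes> inv x) = f (z \<otimes> (y \<otimes> inv x))"
      using comm2[of "y \<otimes> z" x] comm[of y z "inv x"] comm2[of z "y \<otimes> inv x"] by (simp_all add: m_assoc)
    then have 2: "f (x \<otimes> y \<otimes> z) + f (z \<otimes> (y \<otimes> inv x)) = 2 * f (y \<otimes> z) + 2 * f x"
      using pl[of "y \<otimes> z" x] by simp
    have 3: "f (x \<otimes> inv y \<otimes> z) + f (z \<otimes> (y \<otimes> inv x)) = 2 * f z + 2 * f (x \<otimes> inv y)"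
      using pl[of z "x \<otimes> inv y"] comm2[of z "x \<otimes> inv y"] by (simp add: inv_mult_group)
    have 4: "f (x \<otimes> y) + f (x \<otimes> inv y) = 2 * f x + 2 * f y"
      by (rule pl) simp_all
    have "2 * f (x \<otimes> y \<otimes> z) = (f (x \<otimes> y \<otimes> z) + f (x \<otimes> inv y \<otimes> z))
        + (f (x \<otimes> y \<otimes> z) + f (z \<otimes> (y \<otimes> inv x)))
        - (f (x \<otimes> inv y \<otimes> z) + f (z \<otimes> (y \<otimes> inv x)))"
      by simp
    also have "\<dots> = 2 * (f (x \<otimes> z) + f (y \<otimes> z) - f z + f x + f y - f (x \<otimes> inv y))"
      unfolding 1 2 3 by (simp add: algebra_simps)
    also have "f (x \<otimes> inv y) = 2 * f x + 2 * f y - f (x \<otimes> y)"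
      using 4 by (simp add: algebra_simps)
    finally have "2 * f (x \<otimes> y \<otimes> z) =
        2 * (f (x \<otimes> z) + f (y \<otimes> z) + f (x \<otimes> y) - f x - f y - f z)"
      by (simp add: algebra_simps)
    then show ?thesis by (simp only: mult_cancel_left) simp
  qed
  show "bimorphism G (polar_form G f)"
    unfolding bimorphism_def
  proof (intro ballI conjI)
    fix x y z assume [simp]: "x \<in> carrier G" "y \<in> carrier G" "z \<in> carrier G"
    show "polar_form G f (x \<otimes> y) z = polar_form G f x z + polar_form G f y z"
      by (simp add: polar_form_def three flip: add_divide_distrib)
    show "polar_form G f x (y \<otimes> z) = polar_form G f x y + polar_form G f x z"
      by (simp add: polar_form_def three flip: m_assoc add_divide_distrib)
  qed
qed

section \<open>A trace identity for triples of two by two matrices\<close>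

definition triple_trace :: "(3 \<Rightarrow> 'r::comm_ring_1^2^2) \<Rightarrow> 'r" where
  "triple_trace X = trace (X 1 ** X 2 ** X 3) - trace (X 1 ** X 3 ** X 2)"

definition polar_trace :: "'r::comm_ring_1^2^2 \<Rightarrow> 'r^2^2 \<Rightarrow> 'r" where
  "polar_trace A B = 2 * trace (A ** B) - trace A * trace B"

lemma trace_2: "trace (A :: 'r::comm_ring_1^2^2) = A$1$1 + A$2$2"
  by (simp add: trace_def sum_2)

text \<open>
  Coordinates on the matrices modulo scalar ones: both sides of the trace identity depend only on
  these, because scalar matrices contribute neither to \<open>polar_trace\<close> nor to
  \<open>triple_trace\<close>.
\<close>

definition traceless_coords :: "'r::comm_ring_1^2^2 \<Rightarrow> 'r^3" where
  "traceless_coords A = vector [A$1$1 - A$2$2, A$1$2, A$2$1]"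

text \<open>
  The triple trace is an alternating trilinear form on the rank three module of matrices modulo
  scalar ones, hence a multiple of the determinant; in these coordinates the multiple is 1.
\<close>

lemma det_traceless_coords:
  "det (\<chi> i. traceless_coords (X i)) = triple_trace X"
  for X :: "3 \<Rightarrow> 'r::comm_ring_1^2^2"
  unfolding triple_trace_def det_3 traceless_coords_def
  by (simp add: trace_2 matrix_matrix_mult_def sum_2 vector_3) (simp add: algebra_simps)

text \<open>
  The form \<open>polar_trace\<close> has in these coordinates a fixed Gram matrix \<open>J\<close>, so the left-hand
  side is \<open>det (V J W\<^sup>T)\<close> with the determinants of \<open>V\<close> and \<open>W\<close> being triple traces; the constant
  is \<open>det J\<close>.
\<close>

lemma det_polar_trace:
  fixes X Y :: "3 \<Rightarrow> 'r::comm_ring_1^2^2"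
  shows "det ((\<chi> i j. polar_trace (X i) (Y j)) :: 'r^3^3) = - 4 * triple_trace X * triple_trace Y"
proof -
  let ?V = "(\<chi> i. traceless_coords (X i)) :: 'r^3^3"
  let ?W = "(\<chi> i. traceless_coords (Y i)) :: 'r^3^3"
  let ?J = "vector [vector [1, 0, 0], vector [0, 0, 2], vector [0, 2, 0]] :: 'r^3^3"
  have "polar_trace A B = (\<Sum>k\<in>UNIV. (\<Sum>l\<in>UNIV. traceless_coords A $ l * ?J $ l $ k) * traceless_coords B $ k)"
    for A B :: "'r^2^2"
    by (simp add: polar_trace_def traceless_coords_def sum_3 vector_3 trace_2 matrix_matrix_mult_def sum_2)
       (simp add: algebra_simps)
  then have "(\<chi> i j. polar_trace (X i) (Y j)) = ?V ** ?J ** transpose ?W"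
    by (simp add: vec_eq_iff matrix_matrix_mult_def transpose_def)
  moreover have "det ?J = - 4"
    by (simp add: det_3 vector_3)
  ultimately show ?thesis
    by (simp add: det_mul det_transpose det_traceless_coords)
qed

section \<open>Substitution in polynomials\<close>

definition poly_endo :: "('n entry_poly \<Rightarrow> 'n entry_poly) \<Rightarrow> bool" where
  "poly_endo h \<longleftrightarrow> (\<forall>p q. h (p + q) = h p + h q) \<and> (\<forall>p q. h (p * q) = h p * h q) \<and>
     (\<forall>c. h (const_poly c) = const_poly c)"

definition entry_var :: "'n \<times> 2 \<times> 2 \<Rightarrow> 'n entry_poly" where
  "entry_var x = Poly_Mapping.single (Poly_Mapping.single x 1) 1"

definition monomial_value :: "('n \<times> 2 \<times> 2 \<Rightarrow> 'n entry_poly) \<Rightarrow> ('n \<times> 2 \<times> 2 \<Rightarrow>\<^sub>0 nat) \<Rightarrow> 'n entry_poly" where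
  "monomial_value \<theta> m = (\<Prod>x\<in>Poly_Mapping.keys m. \<theta> x ^ Poly_Mapping.lookup m x)"

lemma poly_mapping_sum_singles:
  "p = (\<Sum>m\<in>Poly_Mapping.keys p. Poly_Mapping.single m (Poly_Mapping.lookup p m))"
proof (rule poly_mapping_eqI)
  fix k
  have "Poly_Mapping.lookup (\<Sum>m\<in>Poly_Mapping.keys p. Poly_Mapping.single m (Poly_Mapping.lookup p m)) k
      = (\<Sum>m\<in>Poly_Mapping.keys p. if m = k then Poly_Mapping.lookup p m else 0)"
    by (simp add: lookup_sum lookup_single when_def)
  also have "\<dots> = Poly_Mapping.lookup p k"
    by (simp add: sum.delta' not_in_keys_iff_lookup_eq_zero)
  finally show "Poly_Mapping.lookup p k =
      Poly_Mapping.lookup (\<Sum>m\<in>Poly_Mapping.keys p. Poly_Mapping.single m (Poly_Mapping.lookup p m)) k" ..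
qed

lemma const_poly_simps:
  "const_poly (a + b) = const_poly a + const_poly b"
  "const_poly (a * b) = const_poly a * const_poly b"
  "const_poly 0 = 0" "const_poly 1 = 1" "const_poly (numeral k) = numeral k"
  "const_poly (- a) = - const_poly a"
  by (simp_all add: const_poly_def single_add mult_single single_uminus)

lemma monomial_value_superset:
  assumes "finite S" "Poly_Mapping.keys m \<subseteq> S"
  shows "monomial_value \<theta> m = (\<Prod>x\<in>S. \<theta> x ^ Poly_Mapping.lookup m x)"
  unfolding monomial_value_def
  by (rule prod.mono_neutral_left) (use assms in \<open>auto simp: in_keys_iff\<close>)

lemma monomial_value_add: "monomial_value \<theta> (m + n) = monomial_value \<theta> m * monomial_value \<theta> n"
proof -
  let ?S = "Poly_Mapping.keys m \<union> Poly_Mapping.keys n"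
  have "Poly_Mapping.keys (m + n) \<subseteq> ?S" by (rule keys_add)
  then show ?thesis
    by (simp add: monomial_value_superset[of ?S] lookup_add power_add prod.distrib)
qed

lemma poly_subst_superset:
  assumes "finite S" "Poly_Mapping.keys p \<subseteq> S"
  shows "poly_subst \<theta> p = (\<Sum>m\<in>S. const_poly (Poly_Mapping.lookup p m) * monomial_value \<theta> m)"
  unfolding poly_subst_def monomial_value_def[symmetric]
  by (rule sum.mono_neutral_left) (use assms in \<open>auto simp: in_keys_iff const_poly_simps\<close>)

lemma poly_subst_add: "poly_subst \<theta> (p + q) = poly_subst \<theta> p + poly_subst \<theta> q"
proof -
  let ?S = "Poly_Mapping.keys p \<union> Poly_Mapping.keys q"
  have "Poly_Mapping.keys (p + q) \<subseteq> ?S" by (rule keys_add)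
  then show ?thesis
    by (simp add: poly_subst_superset[of ?S] lookup_add const_poly_simps distrib_right sum.distrib)
qed

lemma poly_subst_zero: "poly_subst \<theta> 0 = 0"
  by (simp add: poly_subst_def)

lemma poly_subst_sum: "poly_subst \<theta> (\<Sum>i\<in>I. p i) = (\<Sum>i\<in>I. poly_subst \<theta> (p i))"
  by (induction I rule: infinite_finite_induct) (simp_all add: poly_subst_zero poly_subst_add)

lemma poly_subst_single: "poly_subst \<theta> (Poly_Mapping.single m c) = const_poly c * monomial_value \<theta> m"
  by (subst poly_subst_superset[of "{m}"]) simp_all

text \<open>
  By distributivity it suffices to multiply two terms, where the claim is that evaluation of
  monomials turns sums of exponent vectors into products.
\<close>

lemma poly_subst_mult: "poly_subst \<theta> (p * q) = poly_subst \<theta> p * poly_subst \<theta> q"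
proof -
  have single: "poly_subst \<theta> (Poly_Mapping.single m c * Poly_Mapping.single n d) =
      poly_subst \<theta> (Poly_Mapping.single m c) * poly_subst \<theta> (Poly_Mapping.single n d)" for m n c d
    by (simp add: mult_single poly_subst_single monomial_value_add const_poly_simps ac_simps)
  show ?thesis
    by (subst (1 2) poly_mapping_sum_singles[of p], subst (1 2) poly_mapping_sum_singles[of q])
       (simp only: sum_distrib_left sum_distrib_right poly_subst_sum single)
qed

lemma poly_endo_subst: "poly_endo (poly_subst \<theta>)"
  by (simp add: poly_endo_def poly_subst_add poly_subst_mult const_poly_def poly_subst_single
      monomial_value_def)

lemma poly_subst_entry_var: "poly_subst \<theta> (entry_var x) = \<theta> x"
  by (simp add: entry_var_def poly_subst_single monomial_value_def const_poly_simps)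

context
  fixes h :: "'n entry_poly \<Rightarrow> 'n entry_poly"
  assumes h: "poly_endo h"
begin

lemma endo_add: "h (p + q) = h p + h q" and endo_mult: "h (p * q) = h p * h q"
  and endo_const: "h (const_poly c) = const_poly c"
  using h by (simp_all add: poly_endo_def)

lemma endo_zero: "h 0 = 0" and endo_one: "h 1 = 1"
  using endo_const[of 0] endo_const[of 1] by (simp_all add: const_poly_simps)

lemma endo_uminus: "h (- p) = - h p"
  using endo_add[of p "- p"] endo_zero by (simp add: eq_neg_iff_add_eq_0 add.commute)

lemma endo_diff: "h (p - q) = h p - h q"
  using endo_add[of p "- q"] endo_uminus by simp

lemma endo_sum: "h (\<Sum>i\<in>I. p i) = (\<Sum>i\<in>I. h (p i))"
  by (induction I rule: infinite_finite_induct) (simp_all add: endo_zero endo_add)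

lemma endo_prod: "h (\<Prod>i\<in>I. p i) = (\<Prod>i\<in>I. h (p i))"
  by (induction I rule: infinite_finite_induct) (simp_all add: endo_one endo_mult)

lemma endo_power: "h (p ^ k) = h p ^ k"
  by (induction k) (simp_all add: endo_one endo_mult)

text \<open>
  Composition with a substitution is again a substitution; this is how two conjugations are
  composed below.
\<close>

lemma endo_poly_subst: "h (poly_subst \<theta> p) = poly_subst (\<lambda>x. h (\<theta> x)) p"
  by (simp add: poly_subst_def endo_sum endo_mult endo_const endo_prod endo_power)

end

lemma single_eq_monomial: "Poly_Mapping.single m 1 = monomial_value entry_var m"
proof -
  have pow: "entry_var x ^ k = Poly_Mapping.single (Poly_Mapping.single x k) 1" for x :: "'n \<times> 2 \<times> 2" and k
    by (induction k) (simp_all add: entry_var_def mult_single flip: single_add)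
  have "(\<Prod>x\<in>S. Poly_Mapping.single (Poly_Mapping.single x (Poly_Mapping.lookup m x)) (1::complex)) =
      Poly_Mapping.single (\<Sum>x\<in>S. Poly_Mapping.single x (Poly_Mapping.lookup m x)) 1" for S
    by (induction S rule: infinite_finite_induct) (simp_all add: mult_single)
  then show ?thesis
    by (simp add: monomial_value_def pow flip: poly_mapping_sum_singles)
qed

lemma poly_subst_id: "poly_subst entry_var p = p"
proof -
  have "poly_subst entry_var p = (\<Sum>m\<in>Poly_Mapping.keys p. Poly_Mapping.single m (Poly_Mapping.lookup p m))"
    unfolding poly_subst_def monomial_value_def[symmetric] single_eq_monomial[symmetric]
    by (simp add: const_poly_def mult_single)
  then show ?thesis by (simp flip: poly_mapping_sum_singles)
qed

section \<open>Conjugation of the generic matrices\<close>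

definition map_entries :: "('r \<Rightarrow> 's) \<Rightarrow> 'r^'m^'k \<Rightarrow> 's^'m^'k" where
  "map_entries h A = (\<chi> i j. h (A $ i $ j))"

lemma const_matrix_mult: "const_matrix (A ** B) = const_matrix A ** const_matrix B"
  by (simp add: const_matrix_def matrix_matrix_mult_def vec_eq_iff sum_2 const_poly_simps)

lemma const_matrix_one: "const_matrix (mat 1) = mat 1"
  by (simp add: const_matrix_def mat_def vec_eq_iff const_poly_simps)

lemma vec2_eqI: "A$1$1 = B$1$1 \<Longrightarrow> A$1$2 = B$1$2 \<Longrightarrow> A$2$1 = B$2$1 \<Longrightarrow> A$2$2 = B$2$2 \<Longrightarrow> A = B"
  for A B :: "'r^2^2"
  by (simp add: vec_eq_iff forall_2)

lemma adjugate2_mult: "adjugate2 (A ** B) = adjugate2 B ** adjugate2 A"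
  by (rule vec2_eqI) (simp_all add: adjugate2_def matrix_matrix_mult_def sum_2 algebra_simps)

lemma adjugate2_left_inverse: "adjugate2 A ** A = mat (det A)"
  by (rule vec2_eqI) (simp_all add: adjugate2_def matrix_matrix_mult_def sum_2 mat_def det_2 algebra_simps)

lemma adjugate2_involutive: "adjugate2 (adjugate2 A) = A"
  by (rule vec2_eqI) (simp_all add: adjugate2_def)

lemma const_matrix_adjugate2: "const_matrix (adjugate2 A) = adjugate2 (const_matrix A)"
  by (rule vec2_eqI) (simp_all add: adjugate2_def const_matrix_def const_poly_simps)

lemma adjugate2_right_inverse: "A ** adjugate2 A = mat (det A)"
  by (rule vec2_eqI) (simp_all add: adjugate2_def matrix_matrix_mult_def sum_2 mat_def det_2 algebra_simps)

lemma det_adjugate2: "det (adjugate2 A) = det A"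
  by (simp add: adjugate2_def det_2 algebra_simps)

lemma matrix_inv_eq_adjugate2:
  assumes "det g = 1"
  shows "matrix_inv g = adjugate2 g"
  unfolding matrix_inv_def
proof (rule some_equality)
  show "g ** adjugate2 g = mat 1 \<and> adjugate2 g ** g = mat 1"
    using assms by (simp add: adjugate2_left_inverse adjugate2_right_inverse)
next
  fix h assume "g ** h = mat 1 \<and> h ** g = mat 1"
  then have "h = adjugate2 g ** g ** h" "adjugate2 g ** (g ** h) = adjugate2 g"
    using assms by (simp_all add: adjugate2_left_inverse)
  then show "h = adjugate2 g" by (simp add: matrix_mul_assoc)
qed

lemma map_entries_mult:
  "poly_endo h \<Longrightarrow> map_entries h (A ** B) = map_entries h A ** map_entries h B"
  by (simp add: map_entries_def matrix_matrix_mult_def vec_eq_iff endo_sum endo_mult)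

lemma map_entries_one: "poly_endo h \<Longrightarrow> map_entries h (mat 1) = mat 1"
  by (simp add: map_entries_def mat_def vec_eq_iff endo_one endo_zero)

lemma map_entries_adjugate2: "poly_endo h \<Longrightarrow> map_entries h (adjugate2 A) = adjugate2 (map_entries h A)"
  by (rule vec2_eqI) (simp_all add: map_entries_def adjugate2_def endo_uminus)

lemma map_entries_const: "poly_endo h \<Longrightarrow> map_entries h (const_matrix A) = const_matrix A"
  by (simp add: map_entries_def const_matrix_def vec_eq_iff endo_const)

lemma trace_map_entries: "poly_endo h \<Longrightarrow> h (trace A) = trace (map_entries h A)"
  by (simp add: trace_def map_entries_def endo_sum)

lemma det_map_entries: "poly_endo h \<Longrightarrow> h (det A) = det (map_entries h A)" for A :: "'n entry_poly^2^2"
  by (simp add: det_2 map_entries_def endo_diff endo_mult)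

definition conj_matrix :: "complex^2^2 \<Rightarrow> 'n entry_poly^2^2 \<Rightarrow> 'n entry_poly^2^2" where
  "conj_matrix g A = const_matrix (matrix_inv g) ** A ** const_matrix g"

context
  fixes g :: "complex^2^2"
  assumes g: "det g = 1"
begin

lemma const_matrix_inv_mult: "const_matrix (matrix_inv g) ** const_matrix g = mat 1"
  and const_matrix_mult_inv: "const_matrix g ** const_matrix (matrix_inv g) = mat 1"
  using g by (simp_all add: matrix_inv_eq_adjugate2 adjugate2_left_inverse adjugate2_right_inverse
      const_matrix_one flip: const_matrix_mult)

lemma conj_matrix_one: "conj_matrix g (mat 1) = mat 1"
  by (simp add: conj_matrix_def const_matrix_inv_mult)

lemma conj_matrix_mult: "conj_matrix g (A ** B) = conj_matrix g A ** conj_matrix g B"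
proof -
  have "conj_matrix g A ** conj_matrix g B =
      const_matrix (matrix_inv g) ** A ** (const_matrix g ** const_matrix (matrix_inv g)) ** B ** const_matrix g"
    by (simp add: conj_matrix_def matrix_mul_assoc)
  then show ?thesis
    by (simp add: conj_matrix_def const_matrix_mult_inv matrix_mul_assoc)
qed

lemma conj_matrix_adjugate2: "conj_matrix g (adjugate2 A) = adjugate2 (conj_matrix g A)"
  by (simp add: conj_matrix_def adjugate2_mult matrix_inv_eq_adjugate2[OF g]
      const_matrix_adjugate2 adjugate2_involutive matrix_mul_assoc)

lemma trace_conj_matrix: "trace (conj_matrix g A) = trace A"
proof -
  have "trace (conj_matrix g A) = trace (const_matrix g ** const_matrix (matrix_inv g) ** A)"
    unfolding conj_matrix_def by (subst trace_mul_sym) (simp add: matrix_mul_assoc)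
  then show ?thesis by (simp add: const_matrix_mult_inv)
qed

lemma det_conj_matrix: "det (conj_matrix g A) = det A" for A :: "'n entry_poly^2^2"
proof -
  have "det (const_matrix (matrix_inv g)) * det (const_matrix g :: 'n entry_poly^2^2) = 1"
    by (metis const_matrix_inv_mult det_mul det_I)
  then show ?thesis by (simp add: conj_matrix_def det_mul ac_simps)
qed

lemma poly_endo_conj: "poly_endo (conj_poly g)"
  unfolding conj_poly_def by (rule poly_endo_subst)

lemma conj_poly_generic: "map_entries (conj_poly g) (generic_matrix l) = conj_matrix g (generic_matrix l)"
  for l :: 'n
proof -
  have "generic_matrix l $ i $ j = entry_var (l, i, j)" for l :: 'n and i j
    by (simp add: generic_matrix_def entry_var_def)
  then show ?thesis
    by (simp add: map_entries_def conj_poly_def poly_subst_entry_var conj_matrix_def vec_eq_iff)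
qed

text \<open>
  Conjugation is multiplicative and commutes with adjugates, so the statement for the generic
  matrices extends to words.
\<close>

lemma conj_poly_word_matrix: "map_entries (conj_poly g) (word_matrix w) = conj_matrix g (word_matrix w)"
  by (induction w)
     (simp_all add: map_entries_one map_entries_mult map_entries_adjugate2 poly_endo_conj
       conj_poly_generic conj_matrix_one conj_matrix_mult conj_matrix_adjugate2)

lemma conj_poly_trace_word: "conj_poly g (trace (word_matrix w)) = trace (word_matrix w)"
  by (simp add: trace_map_entries poly_endo_conj conj_poly_word_matrix trace_conj_matrix)

end

text \<open>
  Both sides are substitutions, hence it is enough to compare them on the entries of
  the generic matrices.
\<close>

lemma conj_poly_inverse:
  assumes g: "det g = 1"
  shows "conj_poly g (conj_poly (matrix_inv g) p) = p"
proof -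
  let ?C = "const_matrix :: _ \<Rightarrow> 'a entry_poly^2^2"
  have inv: "matrix_inv (matrix_inv g) = g" "det (matrix_inv g) = 1"
    using g by (simp_all add: matrix_inv_eq_adjugate2 det_adjugate2 adjugate2_involutive)
  have "map_entries (conj_poly g) (?C g ** generic_matrix l ** ?C (matrix_inv g)) = generic_matrix l" for l
  proof -
    have "map_entries (conj_poly g) (?C g ** generic_matrix l ** ?C (matrix_inv g)) =
        (?C g ** ?C (matrix_inv g)) ** generic_matrix l ** (?C g ** ?C (matrix_inv g))"
      by (simp add: map_entries_mult map_entries_const poly_endo_conj[OF g] conj_poly_generic[OF g]
          conj_matrix_def matrix_mul_assoc)
    then show ?thesis by (simp add: const_matrix_mult_inv[OF g])
  qed
  then have "conj_poly g ((?C g ** generic_matrix l ** ?C (matrix_inv g)) $ i $ j) = entry_var (l, i, j)" for l i j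
    by (simp add: map_entries_def vec_eq_iff generic_matrix_def entry_var_def)
  then show ?thesis
    by (subst (2) conj_poly_def)
       (simp add: endo_poly_subst[OF poly_endo_conj[OF g]] inv case_prod_unfold poly_subst_id)
qed

section \<open>Quotients by ideals and the invariant ring\<close>

lemma univ_ring_simps:
  "carrier univ_ring = UNIV" "mult univ_ring = (*)" "one univ_ring = 1" "zero univ_ring = 0" "add univ_ring = (+)"
  by (simp_all add: univ_ring_def)

lemma cring_univ_ring: "cring (univ_ring :: 'r::comm_ring_1 ring)"
proof (rule cringI)
  show "abelian_group (univ_ring :: 'r ring)"
    by (rule abelian_groupI) (auto simp: univ_ring_simps ac_simps intro: exI[of _ "- x" for x] left_minus)
  show "Group.comm_monoid (univ_ring :: 'r ring)"
    by (rule comm_monoidI) (auto simp: univ_ring_simps ac_simps)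
qed (simp add: univ_ring_simps algebra_simps)

context
  fixes I :: "'r::comm_ring_1 set"
  assumes I: "ideal I univ_ring"
begin

lemma univ_ideal_zero: "0 \<in> I"
  and univ_ideal_add: "a \<in> I \<Longrightarrow> b \<in> I \<Longrightarrow> a + b \<in> I"
  and univ_ideal_mult: "a \<in> I \<Longrightarrow> r * a \<in> I"
  using additive_subgroup.zero_closed[OF ideal.axioms(1)[OF I]]
    additive_subgroup.a_closed[OF ideal.axioms(1)[OF I], of a b]
    ideal.I_l_closed[OF I, of a r]
  by (simp_all add: univ_ring_simps)

lemma univ_ideal_uminus: "a \<in> I \<Longrightarrow> - a \<in> I"
  using univ_ideal_mult[of a "- 1"] by simp

lemma univ_coset_iff: "p \<in> I +>\<^bsub>univ_ring\<^esub> q \<longleftrightarrow> p - q \<in> I"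
proof -
  have "p \<in> I +>\<^bsub>univ_ring\<^esub> q \<longleftrightarrow> (\<exists>h\<in>I. p = h + q)"
    by (simp add: a_r_coset_def r_coset_def univ_ring_simps)
  also have "\<dots> \<longleftrightarrow> p - q \<in> I"
    by (metis add_diff_cancel_right' diff_add_cancel)
  finally show ?thesis .
qed

lemma univ_coset_eq_iff: "I +>\<^bsub>univ_ring\<^esub> p = I +>\<^bsub>univ_ring\<^esub> q \<longleftrightarrow> p - q \<in> I"
proof
  assume "I +>\<^bsub>univ_ring\<^esub> p = I +>\<^bsub>univ_ring\<^esub> q"
  moreover have "p \<in> I +>\<^bsub>univ_ring\<^esub> p" by (simp add: univ_coset_iff univ_ideal_zero)
  ultimately show "p - q \<in> I" by (simp add: univ_coset_iff)
next
  assume pq: "p - q \<in> I"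
  have "r - p \<in> I \<longleftrightarrow> r - q \<in> I" for r
    using univ_ideal_add[OF _ pq, of "r - p"] univ_ideal_add[OF _ univ_ideal_uminus[OF pq], of "r - q"] by auto
  then show "I +>\<^bsub>univ_ring\<^esub> p = I +>\<^bsub>univ_ring\<^esub> q"
    by (auto simp: univ_coset_iff)
qed

text \<open>
  Matrices with entries in an ideal form a two-sided ideal of the matrix ring.
\<close>

lemma univ_ideal_matrix_mult:
  fixes A :: "'r^2^2"
  assumes "\<And>i j. A $ i $ j \<in> I"
  shows "(B ** A) $ i $ j \<in> I" "(A ** B) $ i $ j \<in> I"
  using assms by (simp_all add: matrix_matrix_mult_def sum_2 univ_ideal_add univ_ideal_mult
      mult.commute[of "A $ _ $ _"])

end

lemma ideal_rep_ideal: "ideal (rep_ideal G \<gamma>) univ_ring"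
  unfolding rep_ideal_def
  by (rule ring.genideal_ideal) (simp_all add: cring.axioms(1)[OF cring_univ_ring] univ_ring_simps)

lemma rep_relations_in_ideal: "p \<in> rep_relations G \<gamma> \<Longrightarrow> p \<in> rep_ideal G \<gamma>"
  unfolding rep_ideal_def
  using ring.genideal_self[OF cring.axioms(1)[OF cring_univ_ring], of "rep_relations G \<gamma>"]
  by (auto simp: univ_ring_simps)

lemma word_relation_in_ideal:
  "word_eval G \<gamma> w = \<one>\<^bsub>G\<^esub> \<Longrightarrow> (word_matrix w - mat 1) $ i $ j \<in> rep_ideal G \<gamma>"
  by (rule rep_relations_in_ideal) (unfold rep_relations_def, blast)

lemma rep_class_eq_iff: "rep_class G \<gamma> p = rep_class G \<gamma> q \<longleftrightarrow> p - q \<in> rep_ideal G \<gamma>"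
  unfolding rep_class_def by (rule univ_coset_eq_iff[OF ideal_rep_ideal])

lemma rep_class_hom: "rep_class G \<gamma> \<in> ring_hom univ_ring (rep_ring G \<gamma>)"
  using ideal.rcos_ring_hom[OF ideal_rep_ideal[of G \<gamma>]]
  by (simp add: rep_ring_def rep_class_def[abs_def])

lemma ideal_trunc: "ideal (PIdl\<^bsub>univ_ring\<^esub> (monom 1 N :: complex poly)) univ_ring"
  by (rule cring.cgenideal_ideal[OF cring_univ_ring]) (simp add: univ_ring_simps)

lemma trunc_class_eq_iff: "trunc_class N p = trunc_class N q \<longleftrightarrow> monom 1 N dvd p - q"
  unfolding trunc_class_def univ_coset_eq_iff[OF ideal_trunc]
  by (auto simp: cgenideal_def univ_ring_simps dvd_def mult.commute)

lemma trunc_class_hom: "trunc_class N \<in> ring_hom univ_ring (trunc_ring N)"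
  using ideal.rcos_ring_hom[OF ideal_trunc[of N]]
  by (simp add: trunc_ring_def trunc_class_def[abs_def])

text \<open>
  The determinants are invariant, and conjugating \<open>W - 1\<close> for a relator \<open>W\<close> gives a matrix whose
  entries are combinations of those of \<open>W - 1\<close>.  So the preimage of the ideal is an ideal containing
  all relations.
\<close>

lemma conj_poly_rep_ideal:
  assumes g: "det g = 1" and p: "p \<in> rep_ideal G \<gamma>"
  shows "conj_poly g p \<in> rep_ideal G \<gamma>"
proof -
  note endo = poly_endo_conj[OF g]
  let ?J = "{p \<in> carrier univ_ring. conj_poly g p \<in> rep_ideal G \<gamma>}"
  have hom: "ring_hom_ring univ_ring univ_ring (conj_poly g)"
    by (rule ring_hom_ringI)
       (simp_all add: cring.axioms(1)[OF cring_univ_ring] univ_ring_simps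
         endo_add[OF endo] endo_mult[OF endo] endo_one[OF endo])
  have "ideal ?J univ_ring"
    by (rule ring_hom_ring.ideal_vimage[OF hom ideal_rep_ideal])
  moreover have "rep_relations G \<gamma> \<subseteq> ?J"
  proof
    fix r assume "r \<in> rep_relations G \<gamma>"
    then consider (det) l where "r = det (generic_matrix l) - 1"
      | (word) w i j where "r = (word_matrix w - mat 1) $ i $ j" "word_eval G \<gamma> w = \<one>\<^bsub>G\<^esub>"
      by (auto simp: rep_relations_def)
    then have "conj_poly g r \<in> rep_ideal G \<gamma>"
    proof cases
      case det
      then have "conj_poly g r = r"
        by (simp add: endo_diff[OF endo] endo_one[OF endo] det_map_entries[OF endo]
            conj_poly_generic[OF g] det_conj_matrix[OF g])
      then show ?thesis
        using det by (auto intro!: rep_relations_in_ideal simp: rep_relations_def)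
    next
      case word
      let ?D = "word_matrix w - mat 1 :: 'a entry_poly^2^2"
      have "conj_poly g r = (map_entries (conj_poly g) (word_matrix w) - map_entries (conj_poly g) (mat 1)) $ i $ j"
        by (simp add: word map_entries_def endo_diff[OF endo])
      also have "\<dots> = (conj_matrix g (word_matrix w) - conj_matrix g (mat 1)) $ i $ j"
        by (simp add: conj_poly_word_matrix[OF g] map_entries_one[OF endo] conj_matrix_one[OF g])
      also have "conj_matrix g (word_matrix w) - conj_matrix g (mat 1) = conj_matrix g ?D"
        by (rule vec2_eqI) (simp_all add: conj_matrix_def matrix_matrix_mult_def sum_2 algebra_simps)
      also have "conj_matrix g ?D $ i $ j \<in> rep_ideal G \<gamma>"
        unfolding conj_matrix_def
        by (intro univ_ideal_matrix_mult[OF ideal_rep_ideal] word_relation_in_ideal word(2))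
      finally show ?thesis .
    qed
    then show "r \<in> ?J" by (simp add: univ_ring_simps)
  qed
  ultimately have "rep_ideal G \<gamma> \<subseteq> ?J"
    unfolding rep_ideal_def by (rule ring.genideal_minimal[OF cring.axioms(1)[OF cring_univ_ring]])
  with p show ?thesis by auto
qed

definition conj_invariant :: "'n entry_poly \<Rightarrow> bool" where
  "conj_invariant p \<longleftrightarrow> (\<forall>g. det g = 1 \<longrightarrow> conj_poly g p = p)"

lemma conj_invariant_add: "conj_invariant p \<Longrightarrow> conj_invariant q \<Longrightarrow> conj_invariant (p + q)"
  and conj_invariant_mult: "conj_invariant p \<Longrightarrow> conj_invariant q \<Longrightarrow> conj_invariant (p * q)"
  and conj_invariant_const: "conj_invariant (const_poly c)"
  by (simp_all add: conj_invariant_def endo_add[OF poly_endo_conj] endo_mult[OF poly_endo_conj]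
      endo_const[OF poly_endo_conj])

text \<open>
  Invariance of a coset is an equality of sets.  One inclusion holds because the ideal is stable;
  the other applies the first to the inverse of \<open>g\<close>.
\<close>

lemma rep_class_invariant:
  assumes "conj_invariant p"
  shows "rep_class G \<gamma> p \<in> carrier (invariant_ring G \<gamma>)"
proof -
  have "conj_poly g ` rep_class G \<gamma> p = rep_class G \<gamma> p" if g: "det g = 1" for g
  proof -
    have fix_p: "conj_poly h p = p" if "det h = 1" for h
      using assms that by (simp add: conj_invariant_def)
    have sub: "conj_poly h r \<in> rep_class G \<gamma> p" if "r \<in> rep_class G \<gamma> p" "det h = 1" for r h
      using that conj_poly_rep_ideal[of h "r - p" G \<gamma>]
      by (simp add: rep_class_def univ_coset_iff[OF ideal_rep_ideal] endo_diff[OF poly_endo_conj] fix_p)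
    have "det (matrix_inv g) = 1"
      using g by (simp add: matrix_inv_eq_adjugate2 det_adjugate2)
    then have "r \<in> conj_poly g ` rep_class G \<gamma> p" if "r \<in> rep_class G \<gamma> p" for r
      using sub[OF that, of "matrix_inv g"] conj_poly_inverse[OF g, of r] by (metis image_eqI)
    with sub g show ?thesis by blast
  qed
  moreover have "rep_class G \<gamma> p \<in> carrier (rep_ring G \<gamma>)"
    by (rule ring_hom_closed[OF rep_class_hom]) (simp add: univ_ring_simps)
  ultimately show ?thesis by (simp add: invariant_ring_def)
qed

section \<open>The trace identity in the truncated polynomial ring\<close>

lemma word_eval_closed:
  assumes "group G" "range \<gamma> \<subseteq> carrier G"
  shows "word_eval G \<gamma> w \<in> carrier G"
proof -
  interpret group G by fact
  show ?thesis using assms(2) by (induction w) auto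
qed

lemma word_eval_append:
  assumes "group G" "range \<gamma> \<subseteq> carrier G"
  shows "word_eval G \<gamma> (v @ w) = word_eval G \<gamma> v \<otimes>\<^bsub>G\<^esub> word_eval G \<gamma> w"
proof -
  interpret group G by fact
  have "\<gamma> l \<in> carrier G" for l using assms(2) by auto
  then show ?thesis
    by (induction v) (simp_all add: word_eval_closed[OF assms] m_assoc)
qed

lemma word_matrix_append: "word_matrix (v @ w) = word_matrix v ** word_matrix w"
  by (induction v) (simp_all add: matrix_mul_assoc)

lemma ex_word_eval:
  assumes "group G" "range \<gamma> \<subseteq> carrier G" and x: "x \<in> generate G (range \<gamma>)"
  shows "\<exists>w. word_eval G \<gamma> w = x"
  using x
proof induction
  case one
  show ?case by (rule exI[of _ "[]"]) simp
next
  case (incl h)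
  then obtain l where "h = \<gamma> l" by auto
  with assms have "word_eval G \<gamma> [(l, True)] = h"
    by (auto simp: group.is_monoid monoid.r_one range_subsetD)
  then show ?case ..
next
  case (inv h)
  then obtain l where "h = \<gamma> l" by auto
  with assms have "word_eval G \<gamma> [(l, False)] = inv\<^bsub>G\<^esub> h"
    by (auto simp: group.is_monoid monoid.r_one range_subsetD)
  then show ?case ..
next
  case (eng h1 h2)
  then show ?case using word_eval_append[OF assms(1,2)] by metis
qed

lemma matrix_diff_mult: "(A - B) ** C = A ** C - B ** C" for A B :: "'r::ring_1^'m^'k"
  by (simp add: vec_eq_iff matrix_matrix_mult_def left_diff_distrib right_diff_distrib sum_subtractf)

lemma matrix_mult_diff: "A ** (C - D) = A ** C - A ** D" for C :: "'r::ring_1^'k^'m"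
  by (simp add: vec_eq_iff matrix_matrix_mult_def left_diff_distrib right_diff_distrib sum_subtractf)

text \<open>
  Two words \<open>v\<close>, \<open>w\<close> with the same value have congruent matrices: choose a word \<open>u\<close> for the inverse
  of that value; then \<open>vu\<close> and \<open>uw\<close> are relators, so \<open>V \<equiv> V U W \<equiv> W\<close>.
\<close>

lemma trace_function_eq:
  fixes G (structure)
  assumes "group G" "range \<gamma> \<subseteq> carrier G" "generate G (range \<gamma>) = carrier G"
    and w: "word_eval G \<gamma> w = x"
  shows "trace_function G \<gamma> x = rep_class G \<gamma> (trace (word_matrix w))"
proof -
  interpret group G by fact
  define v where "v = (SOME w. word_eval G \<gamma> w = x)"
  have v: "word_eval G \<gamma> v = x"
    unfolding v_def using w by (rule someI)
  have x: "x \<in> carrier G"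
    using word_eval_closed[OF assms(1,2)] w by auto
  then obtain u where u: "word_eval G \<gamma> u = inv x"
    using ex_word_eval[OF assms(1,2)] assms(3) by (metis inv_closed)
  let ?I = "rep_ideal G \<gamma>"
  note ideal = ideal_rep_ideal[of G \<gamma>]
  let ?V = "word_matrix v" and ?W = "word_matrix w" and ?U = "word_matrix u"
  have "(?V ** ?U - mat 1) $ i $ j \<in> ?I" "(?U ** ?W - mat 1) $ i $ j \<in> ?I" for i j
    using x u v w
    by (auto intro!: word_relation_in_ideal simp: word_eval_append[OF assms(1,2)]
        simp flip: word_matrix_append simp del: minus_vec_def vector_minus_component)
  then have "(?V ** (?U ** ?W - mat 1)) $ i $ j \<in> ?I" "((?V ** ?U - mat 1) ** ?W) $ i $ j \<in> ?I" for i j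
    by (auto intro: univ_ideal_matrix_mult[OF ideal])
  moreover have "?V - ?W = (?V ** ?U - mat 1) ** ?W - ?V ** (?U ** ?W - mat 1)"
    by (simp add: matrix_mul_assoc matrix_diff_mult matrix_mult_diff)
  ultimately have "(?V - ?W) $ i $ j \<in> ?I" for i j
    using univ_ideal_add[OF ideal _ univ_ideal_uminus[OF ideal]] by (metis (no_types) diff_conv_add_uminus vector_minus_component)
  then have "trace ?V - trace ?W \<in> ?I"
    using univ_ideal_add[OF ideal, of "(?V - ?W) $ 1 $ 1" "(?V - ?W) $ 2 $ 2"]
    by (simp add: trace_2 algebra_simps)
  then show ?thesis
    by (simp add: trace_function_def rep_class_eq_iff flip: v_def)
qed

text \<open>
  The relation \<open>rel p P\<close> in the proof says that \<open>p\<close> is an invariant polynomial whose class is sent to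
  that of \<open>P\<close>.  It is compatible with the ring operations and relates the trace of a word to \<open>\<tau>\<close> of
  its value, so both sides of the trace identity for word matrices can be carried over.
\<close>

lemma morphism_det_identity:
  fixes G (structure) and q :: "'a \<Rightarrow> complex poly" and x y :: "3 \<Rightarrow> 'a"
  assumes "group G" and gen: "range \<gamma> \<subseteq> carrier G" "generate G (range \<gamma>) = carrier G"
    and morphism: "defines_morphism G \<gamma> N q"
    and x: "range x \<subseteq> carrier G" and y: "range y \<subseteq> carrier G"
  defines "\<tau> \<equiv> \<lambda>a. 2 + q a"
  defines "T \<equiv> \<lambda>z. \<tau> (z 1 \<otimes> z 2 \<otimes> z 3) - \<tau> (z 1 \<otimes> z 3 \<otimes> z 2)"
  shows "monom 1 N dvd
    det ((\<chi> i j. 2 * \<tau> (x i \<otimes> y j) - \<tau> (x i) * \<tau> (y j)) :: complex poly^3^3) + 4 * T x * T y"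
proof -
  interpret group G by fact
  note append = word_eval_append[OF assms(1) gen(1)]
  obtain \<phi> where \<phi>: "\<phi> \<in> ring_hom (invariant_ring G \<gamma>) (trunc_ring N)"
      "\<And>c. \<phi> (rep_class G \<gamma> (const_poly c)) = trunc_class N [:c:]"
      "\<And>a. a \<in> carrier G \<Longrightarrow> \<phi> (u_function G \<gamma> a) = trunc_class N (q a)"
    using morphism by (auto simp: defines_morphism_def algebra_hom_def)
  define rel where "rel p P \<longleftrightarrow> conj_invariant p \<and> \<phi> (rep_class G \<gamma> p) = trunc_class N P" for p P
  have rel_const: "rel (const_poly c) [:c:]" for c
    by (simp add: rel_def conj_invariant_const \<phi>)
  have rel_add: "rel (p + p') (P + P')" if "rel p P" "rel p' P'" for p p' P P'
  proof -
    have "rep_class G \<gamma> (p + p') = rep_class G \<gamma> p \<oplus>\<^bsub>invariant_ring G \<gamma>\<^esub> rep_class G \<gamma> p'"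
      using ring_hom_add[OF rep_class_hom, of p p' G \<gamma>] by (simp add: univ_ring_simps invariant_ring_def)
    moreover have "trunc_class N (P + P') = trunc_class N P \<oplus>\<^bsub>trunc_ring N\<^esub> trunc_class N P'"
      using ring_hom_add[OF trunc_class_hom, of P P' N] by (simp add: univ_ring_simps)
    ultimately show ?thesis
      using that ring_hom_add[OF \<phi>(1)] by (simp add: rel_def conj_invariant_add rep_class_invariant)
  qed
  have rel_mult: "rel (p * p') (P * P')" if "rel p P" "rel p' P'" for p p' P P'
  proof -
    have "rep_class G \<gamma> (p * p') = rep_class G \<gamma> p \<otimes>\<^bsub>invariant_ring G \<gamma>\<^esub> rep_class G \<gamma> p'"
      using ring_hom_mult[OF rep_class_hom, of p p' G \<gamma>] by (simp add: univ_ring_simps invariant_ring_def)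
    moreover have "trunc_class N (P * P') = trunc_class N P \<otimes>\<^bsub>trunc_ring N\<^esub> trunc_class N P'"
      using ring_hom_mult[OF trunc_class_hom, of P P' N] by (simp add: univ_ring_simps)
    ultimately show ?thesis
      using that ring_hom_mult[OF \<phi>(1)] by (simp add: rel_def conj_invariant_mult rep_class_invariant)
  qed
  have rel_numeral: "rel (numeral k) (numeral k)" for k
    using rel_const[of "numeral k"] by (simp add: const_poly_simps numeral_poly)
  have rel_diff: "rel (p - p') (P - P')" if "rel p P" "rel p' P'" for p p' P P'
    using rel_add[OF that(1) rel_mult[OF rel_const[of "- 1"] that(2)]] by (simp add: const_poly_simps)
  have rel_trace: "rel (trace (word_matrix w)) (\<tau> a)" if w: "word_eval G \<gamma> w = a" for w a
  proof -
    interpret R: ring "rep_ring G \<gamma>"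
      unfolding rep_ring_def by (rule ideal.quotient_is_ring[OF ideal_rep_ideal])
    let ?t = "trace (word_matrix w)"
    have a: "a \<in> carrier G" using word_eval_closed[OF assms(1) gen(1)] w by auto
    have closed: "rep_class G \<gamma> p \<in> carrier (rep_ring G \<gamma>)" for p
      by (rule ring_hom_closed[OF rep_class_hom]) (simp add: univ_ring_simps)
    have "rep_class G \<gamma> ?t = rep_class G \<gamma> (?t - const_poly 2) \<oplus>\<^bsub>rep_ring G \<gamma>\<^esub> rep_class G \<gamma> (const_poly 2)"
      using ring_hom_add[OF rep_class_hom, of "?t - const_poly 2" "const_poly 2" G \<gamma>]
      by (simp add: univ_ring_simps)
    then have "u_function G \<gamma> a = rep_class G \<gamma> (?t - const_poly 2)"
      using trace_function_eq[OF assms(1) gen w] closed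
      by (simp add: u_function_def R.minus_eq R.a_assoc R.r_neg)
    moreover have "conj_invariant ?t"
      by (simp add: conj_invariant_def conj_poly_trace_word)
    then have "conj_invariant (?t - const_poly 2)"
      using conj_invariant_add[OF _ conj_invariant_const[of "- 2"]] by (simp add: const_poly_simps)
    ultimately have "rel (?t - const_poly 2) (q a)"
      using \<phi>(3)[OF a] by (simp add: rel_def)
    from rel_add[OF this rel_const[of 2]] show ?thesis
      by (simp add: \<tau>_def numeral_poly add.commute)
  qed
  have "\<exists>w. \<forall>i. word_eval G \<gamma> (w i) = z i" if "range z \<subseteq> carrier G" for z :: "3 \<Rightarrow> 'a"
    using ex_word_eval[OF assms(1) gen(1)] gen(2) that by (intro choice) (auto simp: range_subsetD)
  then obtain v w where v: "\<And>i. word_eval G \<gamma> (v i) = x i" and w: "\<And>i. word_eval G \<gamma> (w i) = y i"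
    using x y by metis
  let ?X = "\<lambda>i. word_matrix (v i)" and ?Y = "\<lambda>i. word_matrix (w i)"
  have rel_pair: "rel (polar_trace (?X i) (?Y j)) (2 * \<tau> (x i \<otimes> y j) - \<tau> (x i) * \<tau> (y j))" for i j
    unfolding polar_trace_def word_matrix_append[symmetric]
    by (intro rel_diff rel_mult rel_numeral rel_trace) (simp_all add: append v w)
  have rel_triple: "rel (triple_trace (\<lambda>i. word_matrix (u i))) (T z)"
    if u: "\<And>i. word_eval G \<gamma> (u i) = z i" for u z
  proof -
    have "z i \<in> carrier G" for i
      using word_eval_closed[OF assms(1) gen(1), of "u i"] u by simp
    then show ?thesis
      unfolding triple_trace_def T_def word_matrix_append[symmetric]
      by (intro rel_diff rel_trace) (simp_all add: append u m_assoc)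
  qed
  have "rel (det ((\<chi> i j. polar_trace (?X i) (?Y j)) :: _^3^3))
     (det ((\<chi> i j. 2 * \<tau> (x i \<otimes> y j) - \<tau> (x i) * \<tau> (y j)) :: complex poly^3^3))"
    unfolding det_3 by (simp, intro rel_diff rel_add rel_mult rel_pair)
  then have "rel (det ((\<chi> i j. polar_trace (?X i) (?Y j)) :: _^3^3) + 4 * triple_trace ?X * triple_trace ?Y)
     (det ((\<chi> i j. 2 * \<tau> (x i \<otimes> y j) - \<tau> (x i) * \<tau> (y j)) :: complex poly^3^3) + 4 * T x * T y)"
    (is "rel ?p ?P")
    by (intro rel_add rel_mult rel_numeral rel_triple v w)
  moreover have "?p = 0" by (simp add: det_polar_trace)
  moreover have "rel 0 0" using rel_const[of 0] by (simp add: const_poly_simps)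
  ultimately show ?thesis
    using trunc_class_eq_iff[of N ?P 0] by (simp add: rel_def)
qed

section \<open>Leading coefficients\<close>

lemma det_scale3:
  "det ((\<chi> i j. c * F i j) :: 'r::comm_ring_1^3^3) = c ^ 3 * det ((\<chi> i j. F i j) :: 'r^3^3)"
proof -
  have "((\<chi> i j. c * F i j) :: 'r^3^3) = (\<chi> i. c *s (\<chi> j. F i j))"
    by (simp add: vec_eq_iff)
  then show ?thesis by (simp only: det_rows_mul) (simp add: power3_eq_cube)
qed

lemma X_dvd_iff: "[:0, 1:] dvd p \<longleftrightarrow> poly p 0 = 0" for p :: "complex poly"
  using poly_eq_0_iff_dvd[of p 0] by simp

text \<open>
  With \<open>q = t r\<close> every entry of the determinant is divisible by \<open>t\<close>, as is each of the two
  triple differences; this makes the powers of \<open>t\<close> explicit.  The constant term of \<open>e\<close> is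
  \<open>2\<^sup>3\<close> times the minor of the leading coefficients, 2 being the factor in \<open>polar_trace\<close>.
\<close>

lemma morphism_leading_identity:
  fixes G (structure) and r :: "'a \<Rightarrow> complex poly" and x y :: "3 \<Rightarrow> 'a"
  assumes "group G" and gen: "range \<gamma> \<subseteq> carrier G" "generate G (range \<gamma>) = carrier G"
    and morphism: "defines_morphism G \<gamma> N (\<lambda>a. [:0, 1:] * r a)"
    and x: "range x \<subseteq> carrier G" and y: "range y \<subseteq> carrier G"
  obtains e :: "complex poly" where
    "poly e 0 = 8 * det ((\<chi> i j. poly (r (x i \<otimes> y j) - r (x i) - r (y j)) 0) :: complex^3^3)"
    "[:0, 1:] ^ N dvd [:0, 1:] ^ 3 * e + 4 * [:0, 1:] ^ 2
      * (r (x 1 \<otimes> x 2 \<otimes> x 3) - r (x 1 \<otimes> x 3 \<otimes> x 2)) * (r (y 1 \<otimes> y 2 \<otimes> y 3) - r (y 1 \<otimes> y 3 \<otimes> y 2))"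
proof
  define t where "t = ([:0, 1:] :: complex poly)"
  define \<tau> where "\<tau> a = 2 + t * r a" for a
  define T where "T q z = q (z 1 \<otimes> z 2 \<otimes> z 3) - q (z 1 \<otimes> z 3 \<otimes> z 2)" for q :: "'a \<Rightarrow> complex poly" and z :: "3 \<Rightarrow> 'a"
  define E where "E i j = 2 * (r (x i \<otimes> y j) - r (x i) - r (y j)) - t * r (x i) * r (y j)" for i j
  let ?e = "det ((\<chi> i j. E i j) :: complex poly^3^3)"
  have "monom 1 N = t ^ N"
    by (simp add: monom_altdef t_def)
  then have dvd: "t ^ N dvd det ((\<chi> i j. 2 * \<tau> (x i \<otimes> y j) - \<tau> (x i) * \<tau> (y j)) :: complex poly^3^3)
      + 4 * T \<tau> x * T \<tau> y"
    using morphism_det_identity[OF assms(1) gen morphism x y] by (simp only: T_def \<tau>_def t_def)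
  have "2 * \<tau> (x i \<otimes> y j) - \<tau> (x i) * \<tau> (y j) = t * E i j" for i j
    by (simp add: \<tau>_def E_def algebra_simps)
  moreover have "T \<tau> z = t * T r z" for z
    by (simp add: T_def \<tau>_def algebra_simps)
  ultimately have "t ^ N dvd t ^ 3 * ?e + 4 * t ^ 2 * T r x * T r y"
    using dvd by (simp add: det_scale3 power2_eq_square mult.assoc mult.left_commute)
  then show "[:0, 1:] ^ N dvd [:0, 1:] ^ 3 * ?e + 4 * [:0, 1:] ^ 2
      * (r (x 1 \<otimes> x 2 \<otimes> x 3) - r (x 1 \<otimes> x 3 \<otimes> x 2)) * (r (y 1 \<otimes> y 2 \<otimes> y 3) - r (y 1 \<otimes> y 3 \<otimes> y 2))"
    by (simp only: T_def t_def)
  have "poly (E i j) 0 = 2 * poly (r (x i \<otimes> y j) - r (x i) - r (y j)) 0" for i j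
    by (simp add: E_def t_def)
  moreover have "poly ?e 0 = det ((\<chi> i j. poly (E i j) 0) :: complex^3^3)"
    by (simp add: det_3)
  ultimately show "poly ?e 0 = 8 * det ((\<chi> i j. poly (r (x i \<otimes> y j) - r (x i) - r (y j)) 0) :: complex^3^3)"
    by (simp only: det_scale3) simp
qed

text \<open>
  The identity for the triple \<open>(a, b, c)\<close> taken twice has the square of the difference as
  its coefficient at \<open>t\<^sup>2\<close>, up to a factor 4.
\<close>

lemma morphism_exchange_invariant:
  fixes G (structure)
  assumes "group G" and gen: "range \<gamma> \<subseteq> carrier G" "generate G (range \<gamma>) = carrier G"
    and morphism: "defines_morphism G \<gamma> N (\<lambda>a. [:0, 1:] * r a)" and N: "3 \<le> N"
    and abc: "a \<in> carrier G" "b \<in> carrier G" "c \<in> carrier G"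
  shows "poly (r (a \<otimes> b \<otimes> c)) 0 = poly (r (a \<otimes> c \<otimes> b)) 0"
proof -
  define t where "t = ([:0, 1:] :: complex poly)"
  let ?x = "\<lambda>i::3. if i = 1 then a else if i = 2 then b else c"
  let ?d = "r (a \<otimes> b \<otimes> c) - r (a \<otimes> c \<otimes> b)"
  have x: "range ?x \<subseteq> carrier G" using abc by auto
  obtain e where "t ^ N dvd t ^ 3 * e + 4 * t ^ 2 * ?d * ?d"
    by (rule morphism_leading_identity[OF assms(1) gen morphism x x]) (simp add: t_def)
  moreover have "t ^ 3 dvd t ^ N" using N by (rule le_imp_power_dvd)
  ultimately have "t ^ 3 dvd t ^ 3 * e + 4 * t ^ 2 * ?d * ?d"
    by (rule dvd_trans[rotated])
  then have "t ^ 2 * t dvd t ^ 2 * (t * e + 4 * ?d * ?d)"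
    by (simp add: power3_eq_cube power2_eq_square distrib_left mult.assoc mult.left_commute)
  then have "t dvd t * e + 4 * ?d * ?d"
    by (subst (asm) dvd_mult_cancel_left) (simp add: t_def)
  then show ?thesis by (simp add: t_def X_dvd_iff)
qed

text \<open>
  By the previous lemma both triple differences gain one more factor \<open>t\<close>, which moves their product
  to order \<open>t\<^sup>4\<close> and leaves the minor alone at order \<open>t\<^sup>3\<close>.
\<close>

lemma morphism_minors_vanish:
  fixes G (structure) and x y :: "3 \<Rightarrow> 'a"
  assumes "group G" and gen: "range \<gamma> \<subseteq> carrier G" "generate G (range \<gamma>) = carrier G"
    and morphism: "defines_morphism G \<gamma> 4 (\<lambda>a. [:0, 1:] * r a)"
    and x: "range x \<subseteq> carrier G" and y: "range y \<subseteq> carrier G"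
  shows "det ((\<chi> i j. poly (r (x i \<otimes> y j) - r (x i) - r (y j)) 0) :: complex^3^3) = 0"
proof -
  define t where "t = ([:0, 1:] :: complex poly)"
  have "t dvd r (z 1 \<otimes> z 2 \<otimes> z 3) - r (z 1 \<otimes> z 3 \<otimes> z 2)" if "range z \<subseteq> carrier G" for z :: "3 \<Rightarrow> 'a"
    unfolding t_def X_dvd_iff
    using morphism_exchange_invariant[OF assms(1) gen morphism, of "z 1" "z 2" "z 3"] that
    by (simp add: range_subsetD)
  then obtain d d' where d: "r (x 1 \<otimes> x 2 \<otimes> x 3) - r (x 1 \<otimes> x 3 \<otimes> x 2) = t * d"
    and d': "r (y 1 \<otimes> y 2 \<otimes> y 3) - r (y 1 \<otimes> y 3 \<otimes> y 2) = t * d'"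
    using x y by (metis dvdE)
  obtain e where e: "poly e 0 = 8 * det ((\<chi> i j. poly (r (x i \<otimes> y j) - r (x i) - r (y j)) 0) :: complex^3^3)"
    and "t ^ 4 dvd t ^ 3 * e + 4 * t ^ 2 * (t * d) * (t * d')"
    using morphism_leading_identity[OF assms(1) gen morphism x y] unfolding d d' t_def by blast
  then have "t ^ 3 * t dvd t ^ 3 * (e + 4 * t * d * d')"
    by (simp add: eval_nat_numeral distrib_left mult.assoc mult.left_commute)
  then have "t dvd e + 4 * t * d * d'"
    by (subst (asm) dvd_mult_cancel_left) (simp add: t_def)
  with e show ?thesis by (simp add: t_def X_dvd_iff)
qed

section \<open>Forms on the first homology\<close>

text \<open>
  Choose a nonvanishing minor of size at most two of maximal size.  Expanding the bordered minor of
  the next size, which vanishes, expresses every row through the rows of the chosen minor.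
\<close>

lemma vanishing_minors_factor:
  fixes b :: "'a \<Rightarrow> 'a \<Rightarrow> complex"
  assumes minors: "\<And>x y :: 3 \<Rightarrow> 'a. range x \<subseteq> A \<Longrightarrow> range y \<subseteq> A \<Longrightarrow> det ((\<chi> i j. b (x i) (y j)) :: complex^3^3) = 0"
  shows "\<exists>\<alpha> \<beta> g h. \<forall>x\<in>A. \<forall>y\<in>A. b x y = \<alpha> x * g y + \<beta> x * h y"
proof -
  consider (zero) "\<And>x y. x \<in> A \<Longrightarrow> y \<in> A \<Longrightarrow> b x y = 0"
    | (one) p q where "p \<in> A" "q \<in> A" "b p q \<noteq> 0"
        "\<And>x y. x \<in> A \<Longrightarrow> y \<in> A \<Longrightarrow> b x y * b p q = b x q * b p y"
    | (two) p q r s where "p \<in> A" "q \<in> A" "r \<in> A" "s \<in> A" "b r s * b p q \<noteq> b r q * b p s"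
    by metis
  then show ?thesis
  proof cases
    case zero
    show ?thesis
      by (rule exI[of _ "\<lambda>_. 0"])+ (simp add: zero)
  next
    case one
    have "\<forall>x\<in>A. \<forall>y\<in>A. b x y = b x q / b p q * b p y + 0 * 0"
      using one by (simp add: field_simps)
    then show ?thesis
      by (intro exI[of _ "\<lambda>x. b x q / b p q"] exI[of _ "\<lambda>x. 0"] exI[of _ "b p"])
  next
    case two
    define d where "d = b r s * b p q - b r q * b p s"
    have d: "d \<noteq> 0" using two by (simp add: d_def)
    have "\<forall>x\<in>A. \<forall>y\<in>A. b x y = (b r s * b x q - b r q * b x s) / d * b p y
        + (b p q * b x s - b p s * b x q) / d * b r y"
    proof (intro ballI)
      fix x y assume xy: "x \<in> A" "y \<in> A"
      let ?x = "\<lambda>i::3. if i = 1 then x else if i = 2 then p else r"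
      let ?y = "\<lambda>i::3. if i = 1 then y else if i = 2 then q else s"
      have "det ((\<chi> i j. b (?x i) (?y j)) :: complex^3^3) = 0"
        by (rule minors) (use two xy in auto)
      then have "b x y * d = (b r s * b x q - b r q * b x s) * b p y + (b p q * b x s - b p s * b x q) * b r y"
        unfolding d_def by (simp add: det_3 algebra_simps)
      then show "b x y = (b r s * b x q - b r q * b x s) / d * b p y + (b p q * b x s - b p s * b x q) / d * b r y"
        using d by (simp add: eq_divide_eq flip: add_divide_distrib)
    qed
    then show ?thesis
      by (intro exI[of _ "\<lambda>x. (b r s * b x q - b r q * b x s) / d"]
          exI[of _ "\<lambda>x. (b p q * b x s - b p s * b x q) / d"] exI[of _ "b p"] exI[of _ "b r"])
  qed
qed

definition linear_extension :: "('a \<Rightarrow> complex) \<Rightarrow> ('a \<Rightarrow>\<^sub>0 complex) \<Rightarrow> complex" where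
  "linear_extension g v = (\<Sum>x\<in>Poly_Mapping.keys v. Poly_Mapping.lookup v x * g x)"

lemma linear_extension_superset:
  assumes "finite S" "Poly_Mapping.keys v \<subseteq> S"
  shows "linear_extension g v = (\<Sum>x\<in>S. Poly_Mapping.lookup v x * g x)"
  unfolding linear_extension_def
  by (rule sum.mono_neutral_left) (use assms in \<open>auto simp: in_keys_iff\<close>)

lemma linear_extension_add: "linear_extension g (v + w) = linear_extension g v + linear_extension g w"
proof -
  let ?S = "Poly_Mapping.keys v \<union> Poly_Mapping.keys w"
  have "Poly_Mapping.keys (v + w) \<subseteq> ?S" by (rule keys_add)
  then show ?thesis
    by (simp add: linear_extension_superset[of ?S] lookup_add distrib_right sum.distrib)
qed

lemma lookup_chain_scale: "Poly_Mapping.lookup (chain_scale c v) x = c * Poly_Mapping.lookup v x"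
  by (simp add: chain_scale_def map.rep_eq when_def)

lemma linear_extension_scale: "linear_extension g (chain_scale c v) = c * linear_extension g v"
proof -
  have "Poly_Mapping.keys (chain_scale c v) \<subseteq> Poly_Mapping.keys v"
    by (auto simp: in_keys_iff lookup_chain_scale)
  then show ?thesis
    by (simp add: linear_extension_superset[of "Poly_Mapping.keys v"] lookup_chain_scale sum_distrib_left mult.assoc)
qed

lemma linear_extension_single: "linear_extension g (Poly_Mapping.single x c) = c * g x"
  by (subst linear_extension_superset[of "{x}"]) simp_all

lemma linear_extension_diff: "linear_extension g (v - w) = linear_extension g v - linear_extension g w"
  using linear_extension_add[of g "v - w" w] by simp

lemma module_chain_scale: "module chain_scale"
  by unfold_locales (rule poly_mapping_eqI, simp add: lookup_chain_scale lookup_add algebra_simps)+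

text \<open>
  A function that is additive on products kills the generators \<open>[y] - [x y] + [x]\<close>.
\<close>

lemma linear_extension_boundary:
  assumes g: "\<And>x y. x \<in> carrier G \<Longrightarrow> y \<in> carrier G \<Longrightarrow> g (x \<otimes>\<^bsub>G\<^esub> y) = g x + g y"
    and v: "v \<in> boundaries1 G"
  shows "linear_extension g v = 0"
proof -
  interpret module chain_scale by (rule module_chain_scale)
  show ?thesis
    using v unfolding boundaries1_def
  proof (induction rule: span_induct)
    case base
    show ?case by (rule subspaceI) (simp_all add: linear_extension_add linear_extension_scale, simp add: linear_extension_def)
  next
    case (step v)
    then show ?case by (auto simp: linear_extension_add linear_extension_diff linear_extension_single g)
  qed
qed

lemma chain_form_eq_lin: "chain_form b v w = linear_extension (\<lambda>x. linear_extension (b x) w) v"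
  by (simp add: chain_form_def linear_extension_def sum_distrib_left mult.assoc)

lemma linear_extension_cong:
  "v \<in> chains1 G \<Longrightarrow> (\<And>x. x \<in> carrier G \<Longrightarrow> g x = h x) \<Longrightarrow> linear_extension g v = linear_extension h v"
  by (auto simp: linear_extension_def chains1_def intro!: sum.cong)

lemma linear_extension_fun_add: "linear_extension (\<lambda>x. g x + h x) v = linear_extension g v + linear_extension h v"
  by (simp add: linear_extension_def distrib_left sum.distrib)

lemma linear_extension_fun_scale: "linear_extension (\<lambda>x. c * g x) v = c * linear_extension g v"
  by (simp add: linear_extension_def sum_distrib_left mult.left_commute)

text \<open>
  The form is a linear extension in each variable separately, and the function extended is
  additive on the group each time.
\<close>

lemma chain_form_homologous:
  assumes b: "bimorphism G b" and chains: "v \<in> chains1 G" "w' \<in> chains1 G"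
    and hom: "v - v' \<in> boundaries1 G" "w - w' \<in> boundaries1 G"
  shows "chain_form b v w = chain_form b v' w'"
proof -
  have "linear_extension (b x) w = linear_extension (b x) w'" if "x \<in> carrier G" for x
    using linear_extension_boundary[of G "b x", OF _ hom(2)] b that
    by (simp add: bimorphism_def linear_extension_diff)
  then have "chain_form b v w = chain_form b v w'"
    unfolding chain_form_eq_lin by (intro linear_extension_cong[OF chains(1)])
  also have "\<dots> = chain_form b v' w'"
  proof -
    have "linear_extension (b (x \<otimes>\<^bsub>G\<^esub> y)) w' = linear_extension (b x) w' + linear_extension (b y) w'"
      if "x \<in> carrier G" "y \<in> carrier G" for x y
    proof -
      have "linear_extension (b (x \<otimes>\<^bsub>G\<^esub> y)) w' = linear_extension (\<lambda>z. b x z + b y z) w'"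
        by (rule linear_extension_cong[OF chains(2)]) (use b that in \<open>simp add: bimorphism_def\<close>)
      then show ?thesis by (simp add: linear_extension_fun_add)
    qed
    then show ?thesis
      using linear_extension_boundary[of G "\<lambda>x. linear_extension (b x) w'", OF _ hom(1)]
      by (simp add: chain_form_eq_lin linear_extension_diff)
  qed
  finally show ?thesis .
qed

lemma H1_member:
  assumes "X \<in> H1 G"
  shows "X \<noteq> {}" and "v \<in> X \<Longrightarrow> v \<in> chains1 G"
    and "v \<in> X \<Longrightarrow> v' \<in> X \<Longrightarrow> v - v' \<in> boundaries1 G"
proof -
  interpret module chain_scale by (rule module_chain_scale)
  obtain u where u: "u \<in> chains1 G" and X: "X = {w \<in> chains1 G. u - w \<in> boundaries1 G}"
    using assms unfolding H1_def by (elim quotientE) (auto simp: Image_def)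
  have "0 \<in> boundaries1 G"
    unfolding boundaries1_def by (rule span_zero)
  with u have "u \<in> X" unfolding X by simp
  then show "X \<noteq> {}" by blast
  show "v \<in> X \<Longrightarrow> v \<in> chains1 G" unfolding X by blast
  show "v - v' \<in> boundaries1 G" if "v \<in> X" "v' \<in> X"
  proof -
    have "u - v' \<in> boundaries1 G" "u - v \<in> boundaries1 G"
      using that unfolding X by blast+
    then have "(u - v') - (u - v) \<in> boundaries1 G"
      unfolding boundaries1_def by (rule span_diff)
    then show ?thesis by simp
  qed
qed

lemma H1_form_eq:
  assumes b: "bimorphism G b" and XY: "X \<in> H1 G" "Y \<in> H1 G" and vw: "v \<in> X" "w \<in> Y"
  shows "H1_form b X Y = chain_form b v w"
proof -
  have "chain_form b v' w' = chain_form b v w" if "v' \<in> X" "w' \<in> Y" for v' w'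
    by (rule chain_form_homologous[OF b H1_member(2)[OF XY(1) that(1)] H1_member(2)[OF XY(2) vw(2)]
          H1_member(3)[OF XY(1) that(1) vw(1)] H1_member(3)[OF XY(2) that(2) vw(2)]])
  then have "(\<lambda>(v, w). chain_form b v w) p = chain_form b v w" if "p \<in> X \<times> Y" for p
    using that by (cases p) (simp only: mem_Sigma_iff case_prod_conv)
  then have "(\<lambda>(v, w). chain_form b v w) ` (X \<times> Y) = (\<lambda>_. chain_form b v w) ` (X \<times> Y)"
    by (intro image_cong refl)
  also have "\<dots> = {chain_form b v w}"
    using vw by (intro image_constant[of "(v, w)"]) simp
  finally have "(\<lambda>(v, w). chain_form b v w) ` (X \<times> Y) = {chain_form b v w}" .
  then show ?thesis by (simp add: H1_form_def)
qed

text \<open>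
  The form sends a class \<open>X\<close> to a combination of the linear extensions of \<open>g\<close> and \<open>h\<close>.  These
  need not be constant on homology classes, so they are evaluated on a chosen chain in each class,
  which is harmless since the form itself is independent of the choice.
\<close>

lemma form_rank_le_2:
  assumes b: "bimorphism G b"
    and factor: "\<And>x y. x \<in> carrier G \<Longrightarrow> y \<in> carrier G \<Longrightarrow> b x y = \<alpha> x * g y + \<beta> x * h y"
  shows "form_rank (H1 G) (H1_form b) \<le> 2"
proof -
  interpret vector_space "\<lambda>c (\<phi> :: ('a \<Rightarrow>\<^sub>0 complex) set \<Rightarrow> complex) y. c * \<phi> y"
    by unfold_locales (simp_all add: fun_eq_iff algebra_simps)
  define row where "row X Y = (if Y \<in> H1 G then H1_form b X Y else 0)" for X Y
  define ev where "ev k Y = (if Y \<in> H1 G then linear_extension k (SOME w. w \<in> Y) else 0)" for k Y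
  have "row X \<in> span {ev g, ev h}" if X: "X \<in> H1 G" for X
  proof -
    obtain v where v: "v \<in> X" using H1_member(1)[OF X] by blast
    have "row X Y = linear_extension \<alpha> v * ev g Y + linear_extension \<beta> v * ev h Y" for Y
    proof (cases "Y \<in> H1 G")
      case Y: True
      define w where "w = (SOME w. w \<in> Y)"
      have w: "w \<in> Y"
        unfolding w_def using H1_member(1)[OF Y] by (simp add: some_in_eq)
      have "linear_extension (b x) w = \<alpha> x * linear_extension g w + \<beta> x * linear_extension h w" if "x \<in> carrier G" for x
      proof -
        have "linear_extension (b x) w = linear_extension (\<lambda>y. \<alpha> x * g y + \<beta> x * h y) w"
          by (rule linear_extension_cong[OF H1_member(2)[OF Y w]]) (rule factor[OF that])
        then show ?thesis by (simp only: linear_extension_fun_add linear_extension_fun_scale)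
      qed
      then have "chain_form b v w = linear_extension (\<lambda>x. linear_extension g w * \<alpha> x + linear_extension h w * \<beta> x) v"
        unfolding chain_form_eq_lin
        by (intro linear_extension_cong[OF H1_member(2)[OF X v]]) (simp only: mult.commute)
      also have "\<dots> = linear_extension g w * linear_extension \<alpha> v + linear_extension h w * linear_extension \<beta> v"
        by (simp only: linear_extension_fun_add linear_extension_fun_scale)
      finally have "chain_form b v w = linear_extension \<alpha> v * linear_extension g w + linear_extension \<beta> v * linear_extension h w"
        by (simp only: mult.commute)
      then show ?thesis
        using Y by (simp add: row_def ev_def H1_form_eq[OF b X Y v w] flip: w_def)
    qed (simp add: row_def ev_def)
    then have "row X = (\<lambda>Y. linear_extension \<alpha> v * ev g Y) + (\<lambda>Y. linear_extension \<beta> v * ev h Y)"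
      by (intro ext) (simp only: plus_fun_apply)
    also have "\<dots> \<in> span {ev g, ev h}"
      by (intro span_add span_scale span_base) simp_all
    finally show ?thesis .
  qed
  then have "dim (row ` H1 G) \<le> card {ev g, ev h}"
    by (intro dim_le_card) auto
  also have "\<dots> \<le> 2"
    using card_insert_le_m1[of 2 "{ev h}" "ev g"] by simp
  finally show ?thesis by (simp add: form_rank_def row_def[abs_def])
qed

section \<open>Morphisms and the rank of the leading form\<close>

theorem theorem1p4:
  fixes G :: "('a, 'c) monoid_scheme"
    and \<gamma> :: "'n::finite \<Rightarrow> 'a"
    and f1 :: "'a \<Rightarrow> complex"
  assumes "group G"
    and "range \<gamma> \<subseteq> carrier G"
    and "generate G (range \<gamma>) = carrier G"
    and "f1 \<in> parallelogram_functions G"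
  shows "((\<exists>f2. defines_morphism G \<gamma> 3 (\<lambda>x. [:0, f1 x, f2 x:])) \<longrightarrow> quadratic_form G f1) \<and>
         ((\<exists>f2 f3. defines_morphism G \<gamma> 4 (\<lambda>x. [:0, f1 x, f2 x, f3 x:])) \<longrightarrow>
           (\<exists>r\<le>2. quadratic_form_of_rank G f1 r))"
proof (intro conjI impI; elim exE)
  note commute = morphism_exchange_invariant[OF assms(1-3)]
  note polar = parallelogram_polar_form[OF assms(1,4)]
  {
    fix f2 assume "defines_morphism G \<gamma> 3 (\<lambda>x. [:0, f1 x, f2 x:])"
    then have "defines_morphism G \<gamma> 3 (\<lambda>x. [:0, 1:] * [:f1 x, f2 x:])" by simp
    from commute[OF this]
    have "bimorphism G (polar_form G f1)" "\<And>x. x \<in> carrier G \<Longrightarrow> f1 x = polar_form G f1 x x"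
      by (auto intro: polar)
    then show "quadratic_form G f1"
      unfolding quadratic_form_def by blast
  next
    fix f2 f3 assume "defines_morphism G \<gamma> 4 (\<lambda>x. [:0, f1 x, f2 x, f3 x:])"
    then have morphism: "defines_morphism G \<gamma> 4 (\<lambda>x. [:0, 1:] * [:f1 x, f2 x, f3 x:])" by simp
    let ?b = "polar_form G f1"
    from commute[OF morphism]
    have b: "bimorphism G ?b" and sym: "\<And>x y. x \<in> carrier G \<Longrightarrow> y \<in> carrier G \<Longrightarrow> ?b x y = ?b y x"
      and diag: "\<And>x. x \<in> carrier G \<Longrightarrow> f1 x = ?b x x"
      by (auto intro: polar)
    have "det ((\<chi> i j. ?b (x i) (y j)) :: complex^3^3) = 0"
      if "range x \<subseteq> carrier G" "range y \<subseteq> carrier G" for x y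
    proof -
      have "poly ([:f1 (x i \<otimes>\<^bsub>G\<^esub> y j), f2 (x i \<otimes>\<^bsub>G\<^esub> y j), f3 (x i \<otimes>\<^bsub>G\<^esub> y j):] -
          [:f1 (x i), f2 (x i), f3 (x i):] - [:f1 (y j), f2 (y j), f3 (y j):]) 0 = 2 * ?b (x i) (y j)" for i j
        by (simp add: polar_form_def)
      then have "det ((\<chi> i j. 2 * ?b (x i) (y j)) :: complex^3^3) = 0"
        using morphism_minors_vanish[OF assms(1-3) morphism that] by (simp only:)
      then show ?thesis by (simp only: det_scale3) simp
    qed
    from vanishing_minors_factor[of "carrier G" ?b, OF this]
    obtain \<alpha> \<beta> g h
      where "\<And>x y. x \<in> carrier G \<Longrightarrow> y \<in> carrier G \<Longrightarrow> ?b x y = \<alpha> x * g y + \<beta> x * h y"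
      by blast
    then have "form_rank (H1 G) (H1_form ?b) \<le> 2"
      by (rule form_rank_le_2[OF b])
    moreover have "quadratic_form_of_rank G f1 (form_rank (H1 G) (H1_form ?b))"
      unfolding quadratic_form_of_rank_def using b sym diag by (intro exI[of _ ?b]) simp
    ultimately show "\<exists>r\<le>2. quadratic_form_of_rank G f1 r" by blast
  }
qed

end
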